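(* Let $g:\mathbb{N}\to\mathbb{R}$ be a function with $g(n)=o(n/\log n)$ as $n\to\infty$, and let $t=t(n)$ be positive integers with $t(n)=O(2^{g(n)})$. Then, as $n\to\infty$, \[ \mathrm{La}(n,t(n))=(1+o(1))\,\mathrm{La}(n), \] where $\mathrm{La}(n)=\binom{n}{\lfloor n/2\rfloor}$.
   Context: For a family $\mathcal{F}\subseteq 2^{[n]}$ of subsets of $[n]=\{1,\dots,n\}$, $G_\mathcal{F}$ is the graph with vertex set $\mathcal{F}$ in which distinct $A,B\in\mathcal{F}$ are adjacent iff $A\subseteq B$ or $B\subseteq A$. The order of a component is its number of vertices. $\mathrm{La}(n,t)$ denotes the largest size of a family $\mathcal{F}\subseteq 2^{[n]}$ such that every component of $G_\mathcal{F}$ has order at most $t$. $\log$ is base 2. *)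

theory Defs
  imports
    "HOL-Library.Landau_Symbols"
    "Graph_Theory.Graph_Theory"
begin

text \<open>
  Undirected graphs are represented as in the entry Graph Theory, by symmetric arc sets.
\<close>

definition comp_graph :: "nat set set \<Rightarrow> nat set pair_pre_digraph" where
  "comp_graph F =
     \<lparr> pverts = F, parcs = {(A, B). A \<in> F \<and> B \<in> F \<and> A \<noteq> B \<and> (A \<subseteq> B \<or> B \<subseteq> A)} \<rparr>"

text \<open>
  A component is a maximal connected subgraph. The qualified name is needed to avoid confusion
  with topological connectedness.
\<close>

definition is_component :: "('a, 'b) pre_digraph \<Rightarrow> ('a, 'b) pre_digraph \<Rightarrow> bool" where
  "is_component G H \<longleftrightarrow> pre_digraph.max_subgraph G Digraph_Component.connected H"

definition components_le :: "nat \<Rightarrow> nat set set \<Rightarrow> bool" where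
  "components_le t F \<longleftrightarrow> (\<forall>H. is_component (with_proj (comp_graph F)) H \<longrightarrow> card (verts H) \<le> t)"

definition La :: "nat \<Rightarrow> nat \<Rightarrow> nat" where
  "La n t = Max {card F | F. F \<subseteq> Pow {1..n} \<and> components_le t F}"

lemma pair_graph_comp_graph:
  assumes "finite F"
  shows "pair_graph (comp_graph F)"
proof -
  have "parcs (comp_graph F) \<subseteq> F \<times> F"
    by (auto simp: comp_graph_def)
  then have "finite (parcs (comp_graph F))"
    using assms by (meson finite_SigmaI finite_subset)
  then show ?thesis
    using assms by unfold_locales (auto simp: comp_graph_def sym_def symmetric_def)
qed

lemma arc_mono_connected: "arc_mono Digraph_Component.connected"
  unfolding arc_mono_def
  by (metis spanning_def subgraphE wf_digraph.connected_spanning_imp_connected)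

lemma strongly_connected_imp_connected:
  assumes "wf_digraph G" "strongly_connected G"
  shows "Digraph_Component.connected G"
proof -
  interpret wf_digraph G by fact
  have "(u, v) \<in> rtrancl_on (verts G) ((arcs_ends G)\<^sup>s)"
    if "u \<in> verts G" "v \<in> verts G" for u v
  proof -
    have "(u, v) \<in> rtrancl_on (verts G) (arcs_ends G)"
      using assms(2) that by (auto simp: strongly_connected_def reachable_def)
    then show ?thesis
      by (rule rtrancl_on_mono[rotated 2]) (auto simp: symcl_def)
  qed
  then show ?thesis
    using assms(2) by (auto simp: connected_conv strongly_connected_def)
qed

lemma is_component_iff_sccs:
  assumes "sym_digraph G"
  shows "is_component G H \<longleftrightarrow> H \<in> pre_digraph.sccs G"
proof -
  interpret sym_digraph G by fact
  have ind_sc: "strongly_connected K"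
    if "induced_subgraph K G" "Digraph_Component.connected K" for K
  proof -
    have "symmetric K"
      using sym_arcs that(1) by (rule induced_graph_imp_symmetric)
    with that show ?thesis
      using wf_digraph.symmetric_connected_imp_strongly_connected wf_digraphI_induced by blast
  qed
  show ?thesis
  proof
    assume "is_component G H"
    then have m: "max_subgraph Digraph_Component.connected H"
      by (simp add: is_component_def)
    then have i: "induced_subgraph H G"
      using arc_mono_connected by (rule induced_subgraphI_arc_mono)
    then have "strongly_connected H"
      using ind_sc max_subgraph_prop[OF m] by blast
    moreover have "\<not> (induced_subgraph K G \<and> strongly_connected K \<and> verts H \<subset> verts K)" for K
    proof
      assume K: "induced_subgraph K G \<and> strongly_connected K \<and> verts H \<subset> verts K"
      then have sK: "subgraph K G" and wK: "wf_digraph K"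
        by auto
      have cK: "Digraph_Component.connected K"
        using K wK strongly_connected_imp_connected by blast
      have "subgraph H K"
        using i K wK by (fastforce simp: induced_subgraph_def subgraph_def compatible_def)
      then show False
        using m K sK cK by (auto simp: max_subgraph_def)
    qed
    ultimately show "H \<in> sccs"
      using i by (auto simp: sccs_def)
  next
    assume H: "H \<in> sccs"
    then have i: "induced_subgraph H G" and sc: "strongly_connected H"
      by (auto simp: sccs_def)
    have m: "max_subgraph strongly_connected H"
      using H by (simp add: sccs_altdef2)
    have "K = H" if K: "subgraph H K" "subgraph K G" "Digraph_Component.connected K" for K
    proof -
      have vK: "verts K \<subseteq> verts G" using K(2) by auto
      have iK: "induced_subgraph (G \<restriction> verts K) G"
        using vK by (rule induced_induce)
      have KG: "subgraph K (G \<restriction> verts K)"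
        using K(2) by (rule subgraph_induce_subgraphI2)
      have "Digraph_Component.connected (G \<restriction> verts K)"
        using arc_mono_connected KG K(3) unfolding arc_mono_def by fastforce
      then have "strongly_connected (G \<restriction> verts K)"
        using ind_sc iK by blast
      moreover have HG: "subgraph H (G \<restriction> verts K)"
        using K(1) KG by (rule subgraph_trans)
      ultimately have "H = G \<restriction> verts K"
        using m iK by (auto simp: max_subgraph_def)
      then show ?thesis
        using K(1) KG by (auto simp: subgraph_def compatible_def)
    qed
    moreover have "Digraph_Component.connected H"
      using i sc strongly_connected_imp_connected by blast
    ultimately show "is_component G H"
      using i by (auto simp: is_component_def max_subgraph_def)
  qed
qed

lemma components_le_iff:
  assumes "finite F"
  shows "components_le t F \<longleftrightarrow>
    (\<forall>S \<in> pre_digraph.sccs_verts (with_proj (comp_graph F)). card S \<le> t)"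
proof -
  interpret pair_graph "comp_graph F"
    using assms by (rule pair_graph_comp_graph)
  have "sym_digraph (with_proj (comp_graph F))"
    by unfold_locales (rule sym_arcs)
  then show ?thesis
    by (auto simp: components_le_def is_component_iff_sccs sccs_verts_conv)
qed

lemma La_set_finite: "finite {card F | F. F \<subseteq> Pow {1..n} \<and> components_le t F}"
  by (rule finite_subset[of _ "card ` Pow (Pow {1..n})"]) auto

lemma components_le_empty: "components_le t {}"
proof -
  interpret pair_graph "comp_graph {}"
    by (rule pair_graph_comp_graph) simp
  have "S \<notin> sccs_verts" for S
    using reachable_in_verts unfolding sccs_verts_def by (fastforce simp: comp_graph_def)
  then have "sccs_verts = {}"
    by blast
  then show ?thesis
    by (simp add: components_le_iff)
qed

end

theory Submission
  imports Defs "HOL-Combinatorics.Multiset_Permutations" "HOL-Probability.Probability"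
    "HOL-Real_Asymp.Real_Asymp"
begin

text \<open>
  The middle level gives the lower bound. For the upper bound let $X$ be the number of members of the
  family on a uniformly random maximal chain. Since $X \le 1 + {X \choose 2}$, the LYM sum of the
  family is at most $1$ plus the expected number of pairs $A \subset B$ of the family on the chain.
  Such a pair lies inside one component, and its contribution at distance $k$ is at most
  $k!\,(4/n)^k \sqrt{w(A) w(B)}$, where $w$ is the probability of lying on the chain and both sets
  have close to $n/2$ elements.

  So it suffices to bound, for a set $C$ of at most $t$ vertices of the cube, the quadratic form of the
  matrix $M = k! \cdot [\mathrm{dist}(A, B) = k]$ on $C$. Iterating the Cauchy-Schwarz inequality bounds
  its $J$-th power by the form of $M^J$, and $M^J$ is dominated by the number of walks of length
  $kJ$ in the cube between the two points. At length $l \le z^2 n$ there are at most $(2nz)^l$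
  of these, far fewer than $n^l$. With $kJ$ of order $z^2 n \ge \log t$ the factor $t$ that is lost
  by summing over $C$ is harmless, and distance $k$ contributes at most $(16 z)^k$ times the LYM
  sum of $C$. Summing over $k$ leaves an error $O(z)$ for every fixed $z > 0$; only
  $\log t = o(n)$ is needed.
\<close>

section \<open>Walks in the cube\<close>

definition flip :: "'a \<Rightarrow> 'a set \<Rightarrow> 'a set" where
  "flip i A = (if i \<in> A then A - {i} else insert i A)"

definition hdist :: "'a set \<Rightarrow> 'a set \<Rightarrow> nat" where
  "hdist A B = card ((A - B) \<union> (B - A))"

text \<open>The number of walks of length \<open>l\<close> from \<open>A\<close> to \<open>B\<close>
  in the cube on \<open>S\<close>, where each step toggles one element. It is real-valued because it
  is compared with powers of \<open>z\<close>.\<close>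

fun walks :: "'a set \<Rightarrow> nat \<Rightarrow> 'a set \<Rightarrow> 'a set \<Rightarrow> real" where
  "walks S 0 A B = of_bool (A = B)"
| "walks S (Suc l) A B = (\<Sum>i\<in>S. walks S l (flip i A) B)"

lemma hdist_commute: "hdist A B = hdist B A"
  by (simp add: hdist_def Un_commute)

lemma hdist_eq_0_iff:
  assumes "finite A" "finite B"
  shows "hdist A B = 0 \<longleftrightarrow> A = B"
  using assms by (auto simp: hdist_def)

lemma hdist_subset:
  assumes "A \<subseteq> B"
  shows "hdist A B = card (B - A)"
proof -
  have "A - B \<union> (B - A) = B - A"
    using assms by blast
  then show ?thesis
    by (simp add: hdist_def)
qed

lemma finite_flip: "finite A \<Longrightarrow> finite (flip i A)"
  by (simp add: flip_def)

lemma flip_subset: "A \<subseteq> S \<Longrightarrow> i \<in> S \<Longrightarrow> flip i A \<subseteq> S"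
  by (auto simp: flip_def)

lemma hdist_flip_in:
  assumes "finite A" "finite B" "i \<in> (A - B) \<union> (B - A)"
  shows "hdist A B = Suc (hdist (flip i A) B)"
proof -
  have "(flip i A - B) \<union> (B - flip i A) = ((A - B) \<union> (B - A)) - {i}"
    using assms(3) by (auto simp: flip_def)
  moreover have "card ((A - B) \<union> (B - A)) = Suc (card (((A - B) \<union> (B - A)) - {i}))"
    using assms by (intro card.remove) auto
  ultimately show ?thesis
    by (simp add: hdist_def)
qed

lemma hdist_flip_notin:
  assumes "finite A" "finite B" "i \<notin> (A - B) \<union> (B - A)"
  shows "hdist (flip i A) B = Suc (hdist A B)"
proof -
  have "(flip i A - B) \<union> (B - flip i A) = insert i ((A - B) \<union> (B - A))"
    using assms(3) by (auto simp: flip_def)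
  then show ?thesis
    using assms by (simp add: hdist_def)
qed

lemma walks_nonneg: "0 \<le> walks S l A B"
  by (induction l arbitrary: A) (auto intro: sum_nonneg)

lemma walks_eq_0:
  assumes "finite A" "finite B" "l < hdist A B"
  shows "walks S l A B = 0"
  using assms
proof (induction l arbitrary: A)
  case 0
  then show ?case by (auto simp: hdist_def)
next
  case (Suc l)
  have "walks S l (flip i A) B = 0" for i
  proof (rule Suc.IH)
    show "l < hdist (flip i A) B"
      using hdist_flip_in[of A B i] hdist_flip_notin[of A B i] Suc.prems by linarith
  qed (use Suc.prems finite_flip in auto)
  then show ?case by simp
qed

text \<open>Each ordering of the differing elements gives a shortest walk. In the induction every
  differing element is a possible first step. This is what lets the weight k! be replaced by a
  number of walks.\<close>

lemma fact_le_walks: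
  assumes "finite S" "A \<subseteq> S" "B \<subseteq> S"
  shows "fact (hdist A B) \<le> walks S (hdist A B) A B"
  using assms(2)
proof (induction "hdist A B" arbitrary: A)
  case 0
  then show ?case
    using assms hdist_eq_0_iff[of A B] finite_subset by (metis eq_refl fact_0 of_bool_eq(2) walks.simps(1))
next
  case (Suc d)
  let ?D = "(A - B) \<union> (B - A)"
  have fin: "finite A" "finite B"
    using assms Suc.prems finite_subset by blast+
  have *: "fact d \<le> walks S d (flip i A) B" if "i \<in> ?D" for i
  proof -
    have "d = hdist (flip i A) B"
      using hdist_flip_in[OF fin that] Suc.hyps(2) by simp
    then show ?thesis
      using Suc.hyps(1)[of "flip i A"] flip_subset[of A S i] that Suc.prems assms(3) by auto
  qed
  have "(fact (Suc d) :: real) = (\<Sum>i\<in>?D. fact d)"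
    by (simp flip: Suc.hyps(2) hdist_def)
  also have "\<dots> \<le> (\<Sum>i\<in>?D. walks S d (flip i A) B)"
    by (intro sum_mono *)
  also have "\<dots> \<le> (\<Sum>i\<in>S. walks S d (flip i A) B)"
    using assms Suc.prems by (intro sum_mono2) (auto simp: walks_nonneg)
  finally show ?case
    by (simp flip: Suc.hyps(2))
qed

text \<open>Cutting a walk of length k + l after k steps gives the product sum. Only midpoints in
  \<open>C\<close> are counted, hence an inequality.\<close>

lemma walks_compose:
  assumes "finite C"
  shows "(\<Sum>B\<in>C. walks S k A B * walks S l B D) \<le> walks S (k + l) A D"
proof (induction k arbitrary: A)
  case 0
  have "(\<Sum>B\<in>C. walks S 0 A B * walks S l B D)
      = (\<Sum>B\<in>C. if A = B then walks S l A D else 0)"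
    by (intro sum.cong) auto
  also have "\<dots> \<le> walks S l A D"
    using assms by (simp add: walks_nonneg)
  finally show ?case by simp
next
  case (Suc k)
  have "(\<Sum>B\<in>C. walks S (Suc k) A B * walks S l B D)
      = (\<Sum>i\<in>S. \<Sum>B\<in>C. walks S k (flip i A) B * walks S l B D)"
    by (subst sum.swap) (simp add: sum_distrib_right)
  also have "\<dots> \<le> (\<Sum>i\<in>S. walks S (k + l) (flip i A) D)"
    by (intro sum_mono Suc.IH)
  finally show ?case by simp
qed

text \<open>
  The bound is inductive because stepping to a vertex nearer to $B$ costs a factor $1/z$ in
  $z^{\mathrm{dist}(A, B)}$, but only $\mathrm{dist}(A, B) \le l \le z^2 n$ of the $n$ steps do so.
\<close>

lemma walks_le:
  assumes "finite S" "A \<subseteq> S" "B \<subseteq> S" "0 < z" "z \<le> 1" "real l \<le> z\<^sup>2 * real (card S)"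
  shows "walks S l A B \<le> (2 * real (card S) * z) ^ l * z ^ hdist A B"
  using assms(2,6)
proof (induction l arbitrary: A)
  case 0
  then show ?case
    using assms(4) by (auto simp: hdist_def)
next
  case (Suc l)
  let ?D = "(A - B) \<union> (B - A)" and ?n = "real (card S)" and ?d = "hdist A B"
  have fin: "finite A" "finite B"
    using assms Suc.prems finite_subset by blast+
  show ?case
  proof (cases "Suc l < ?d")
    case True
    then show ?thesis
      using walks_eq_0[OF fin True, of S] assms(4) by simp
  next
    case False
    then have d: "real ?d \<le> z\<^sup>2 * ?n"
      using Suc.prems by linarith
    have IH: "walks S l (flip i A) B \<le> (2 * ?n * z) ^ l * z ^ hdist (flip i A) B" if "i \<in> S" for i
      using Suc.IH[of "flip i A"] flip_subset[OF Suc.prems(1) that] Suc.prems(2) by simp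
    have in_D: "walks S l (flip i A) B \<le> (2 * ?n * z) ^ l * (z ^ ?d / z)" if "i \<in> ?D" for i
      using IH[of i] hdist_flip_in[OF fin that] that assms Suc.prems by auto
    have out_D: "walks S l (flip i A) B \<le> (2 * ?n * z) ^ l * (z * z ^ ?d)" if "i \<in> S - ?D" for i
      using IH[of i] hdist_flip_notin[OF fin, of i] that by auto
    have "walks S (Suc l) A B
        = (\<Sum>i\<in>S - ?D. walks S l (flip i A) B) + (\<Sum>i\<in>?D. walks S l (flip i A) B)"
      using assms Suc.prems sum.subset_diff[of ?D S "\<lambda>i. walks S l (flip i A) B"] by auto
    also have "\<dots> \<le> (\<Sum>i\<in>S - ?D. (2 * ?n * z) ^ l * (z * z ^ ?d))
        + (\<Sum>i\<in>?D. (2 * ?n * z) ^ l * (z ^ ?d / z))"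
      using in_D out_D by (intro add_mono sum_mono) auto
    also have "\<dots> = (2 * ?n * z) ^ l * z ^ ?d * (real (card (S - ?D)) * z + real ?d / z)"
      by (simp add: hdist_def algebra_simps)
    \<comment> \<open>The steps away from \<open>B\<close> and the steps towards it each contribute
      at most nz, which is the source of the factor 2 in 2nz.\<close>
    also have "\<dots> \<le> (2 * ?n * z) ^ l * z ^ ?d * (?n * z + ?n * z)"
    proof (intro mult_left_mono add_mono)
      show "real (card (S - ?D)) * z \<le> ?n * z"
        using assms by (intro mult_right_mono) (auto intro: card_mono)
      show "real ?d / z \<le> ?n * z"
        using d assms(4) by (simp add: divide_le_eq power2_eq_square mult_ac)
    qed (use assms in auto)
    finally show ?thesis
      by (simp add: mult_ac)
  qed
qed

section \<open>Power iteration for quadratic forms\<close>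

text \<open>
  Here $a_j = \langle v, M^j v\rangle$. Symmetry gives $a_j^2 \le a_0 a_{2j}$, which is applied $s$ times.
\<close>

lemma power_iteration:
  fixes M :: "'a \<Rightarrow> 'a \<Rightarrow> real" and v :: "'a \<Rightarrow> real"
  assumes fin: "finite C" and sym: "\<And>x y. M x y = M y x"
    and v: "\<And>x. 0 \<le> v x" and M: "\<And>x y. 0 \<le> M x y"
  defines "u \<equiv> \<lambda>j. ((\<lambda>f x. \<Sum>y\<in>C. M x y * f y) ^^ j) v"
  defines "a \<equiv> \<lambda>j. \<Sum>x\<in>C. v x * u j x"
  shows "a 1 ^ (2 ^ s) * a 0 \<le> a 0 ^ (2 ^ s) * a (2 ^ s)"
proof (induction s)
  case 0
  then show ?case by simp
next
  case (Suc s)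
  have u_Suc: "u (Suc j) x = (\<Sum>y\<in>C. M x y * u j y)" for j x
    by (simp add: u_def)
  have u_nonneg: "0 \<le> u j x" for j x
    by (induction j arbitrary: x) (auto simp: u_Suc v M intro!: sum_nonneg, simp add: u_def v)
  have a_nonneg: "0 \<le> a j" for j
    by (auto simp: a_def v u_nonneg intro!: sum_nonneg)
  \<comment> \<open>Symmetry moves one application of \<open>M\<close> from the left vector to the
    right one, so the inner product of \<open>u i\<close> and \<open>u j\<close> depends only on i +
    j.\<close>
  have shift: "(\<Sum>x\<in>C. u (Suc i) x * u j x) = (\<Sum>x\<in>C. u i x * u (Suc j) x)" for i j
  proof -
    have "(\<Sum>x\<in>C. u (Suc i) x * u j x) = (\<Sum>x\<in>C. \<Sum>y\<in>C. M x y * u i y * u j x)"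
      by (simp add: u_Suc sum_distrib_right)
    also have "\<dots> = (\<Sum>y\<in>C. \<Sum>x\<in>C. u i y * (M y x * u j x))"
      by (subst sum.swap) (simp add: sym mult_ac)
    also have "\<dots> = (\<Sum>y\<in>C. u i y * u (Suc j) y)"
      by (simp add: u_Suc sum_distrib_left)
    finally show ?thesis .
  qed
  have inner: "(\<Sum>x\<in>C. u i x * u j x) = a (i + j)" for i j
  proof (induction i arbitrary: j)
    case 0
    then show ?case by (simp add: a_def u_def)
  next
    case (Suc i)
    show ?case using Suc[of "Suc j"] by (simp add: shift)
  qed
  have cs: "(a j)\<^sup>2 \<le> a 0 * a (j + j)" for j
    using Cauchy_Schwarz_ineq_sum[of v "u j" C] inner[of j j] inner[of 0 0]
    by (simp add: a_def u_def power2_eq_square)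
  \<comment> \<open>The claim is (a 1 / a 0)^J \<le> a J / a 0 with denominators cleared, so it also
    covers a 0 = 0. Otherwise, squaring the claim for J and applying \<open>cs\<close> leaves one
    surplus factor a 0 to cancel.\<close>
  show ?case
  proof (cases "a 0 = 0")
    case True
    then show ?thesis
      using a_nonneg by (simp add: zero_power)
  next
    case False
    then have pos: "a 0 > 0"
      using a_nonneg[of 0] by linarith
    let ?J = "2 ^ s :: nat"
    have "(a 1 ^ ?J * a 0)\<^sup>2 \<le> (a 0 ^ ?J * a ?J)\<^sup>2"
      using Suc.IH a_nonneg by (intro power_mono) auto
    also have "\<dots> = (a 0 ^ ?J)\<^sup>2 * (a ?J)\<^sup>2"
      by (simp add: power_mult_distrib)
    also have "\<dots> \<le> (a 0 ^ ?J)\<^sup>2 * (a 0 * a (?J + ?J))"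
      by (intro mult_left_mono cs) auto
    finally have "(a 1 ^ (2 ^ Suc s) * a 0) * a 0 \<le> (a 0 ^ (2 ^ Suc s) * a (2 ^ Suc s)) * a 0"
      by (simp add: power_mult_distrib power2_eq_square mult_2 power_add mult_ac)
    then show ?thesis
      using pos mult_le_cancel_right_pos by blast
  qed
qed

text \<open>The form of M^J is at most (2nz)^(kJ) times the square of the sum of \<open>v\<close>
  over \<open>C\<close>, and Cauchy-Schwarz turns that square into the factor |C|. Since |C| \<le>
  2^(kJ), taking J-th roots costs only 2^k, which changes 2nz into 4nz.\<close>

lemma sum_hdist_le:
  fixes v :: "'a set \<Rightarrow> real"
  assumes S: "finite S" and C: "C \<subseteq> Pow S"
    and z: "0 < z" "z \<le> 1" and k: "0 < k" "real k \<le> z\<^sup>2 * real (card S)"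
    and card_C: "real (card C) \<le> 2 powr (z\<^sup>2 * real (card S) / 2)"
    and v: "\<And>A. 0 \<le> v A"
  shows "(\<Sum>A\<in>C. \<Sum>B\<in>C. of_bool (hdist A B = k) * fact k * (v A * v B))
    \<le> (4 * real (card S) * z) ^ k * (\<Sum>A\<in>C. (v A)\<^sup>2)"
proof -
  define n where "n = real (card S)"
  define M :: "'a set \<Rightarrow> 'a set \<Rightarrow> real" where "M A B = of_bool (hdist A B = k) * fact k" for A B
  define u where "u = (\<lambda>j. ((\<lambda>f A. \<Sum>B\<in>C. M A B * f B) ^^ j) v)"
  define a where "a = (\<lambda>j. \<Sum>A\<in>C. v A * u j A)"
  have fin: "finite C"
    using S C finite_subset by (metis finite_Pow_iff)
  have n: "n > 0"
    using k z by (cases "card S = 0") (auto simp: n_def)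
  have M_nonneg: "0 \<le> M A B" for A B
    by (simp add: M_def)
  have M_sym: "M A B = M B A" for A B
    by (simp add: M_def hdist_commute)
  have u_Suc: "u (Suc j) A = (\<Sum>B\<in>C. M A B * u j B)" for j A
    by (simp add: u_def)
  have M_le: "M A B \<le> walks S k A B" if "A \<in> C" "B \<in> C" for A B
    using fact_le_walks[OF S, of A B] that C walks_nonneg by (auto simp: M_def)
  \<comment> \<open>Entrywise on \<open>C\<close>, the j-th power of \<open>M\<close> is dominated
    by the number of walks of length kj.\<close>
  have u_le: "u j A \<le> (\<Sum>D\<in>C. walks S (k * j) A D * v D)" if "A \<in> C" for j A
    using that
  proof (induction j arbitrary: A)
    case 0
    have "v A = (\<Sum>D\<in>C. if A = D then v D else 0)"
      using fin 0 by simp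
    also have "\<dots> = (\<Sum>D\<in>C. walks S (k * 0) A D * v D)"
      by (intro sum.cong) auto
    finally show ?case by (simp add: u_def)
  next
    case (Suc j)
    have "u (Suc j) A \<le> (\<Sum>B\<in>C. walks S k A B * (\<Sum>D\<in>C. walks S (k * j) B D * v D))"
      unfolding u_Suc
      by (rule sum_mono, rule order_trans[OF mult_left_mono[OF Suc.IH]])
        (use Suc.prems M_le in \<open>auto intro!: mult_right_mono sum_nonneg simp: M_nonneg walks_nonneg v\<close>)
    also have "\<dots> = (\<Sum>D\<in>C. (\<Sum>B\<in>C. walks S k A B * walks S (k * j) B D) * v D)"
      by (simp add: sum_distrib_left sum_distrib_right mult.assoc) (rule sum.swap)
    also have "\<dots> \<le> (\<Sum>D\<in>C. walks S (k + k * j) A D * v D)"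
      by (intro sum_mono mult_right_mono walks_compose fin v)
    finally show ?case by simp
  qed
  have "\<exists>s. real k * 2 ^ s > z\<^sup>2 * n"
  proof -
    obtain s where "z\<^sup>2 * n < 2 ^ s"
      using real_arch_pow[of 2 "z\<^sup>2 * n"] by auto
    moreover have "(1 :: real) * 2 ^ s \<le> real k * 2 ^ s"
      using k(1) by (intro mult_right_mono) auto
    ultimately have "real k * 2 ^ s > z\<^sup>2 * n" by linarith
    then show ?thesis ..
  qed
  define s' where "s' = (LEAST s. real k * 2 ^ s > z\<^sup>2 * n)"
  have s': "real k * 2 ^ s' > z\<^sup>2 * n"
    unfolding s'_def by (rule LeastI_ex) fact
  \<comment> \<open>The hypothesis k \<le> z^2 n says that J = 1 is admissible, so the least
    inadmissible exponent has a predecessor.\<close>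
  have "s' \<noteq> 0"
  proof
    assume "s' = 0"
    then show False
      using s' k(2) by (simp add: n_def)
  qed
  then obtain s where s: "s' = Suc s"
    using not0_implies_Suc by blast
  have len_le: "real k * 2 ^ s \<le> z\<^sup>2 * n"
    using not_less_Least[of s "\<lambda>s. real k * 2 ^ s > z\<^sup>2 * n"] s by (simp add: s'_def not_less)
  \<comment> \<open>the longest admissible walk length $kJ$ with $J$ a power of two; it exceeds $z^2 n / 2$\<close>
  define J :: nat where "J = 2 ^ s"
  have J: "J > 0" "real (k * J) \<le> z\<^sup>2 * n" "z\<^sup>2 * n / 2 \<le> real (k * J)"
    using len_le s' by (auto simp: J_def s)
  have G: "walks S (k * J) A B \<le> (2 * n * z) ^ (k * J)" if "A \<in> C" "B \<in> C" for A B
  proof -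
    have "walks S (k * J) A B \<le> (2 * n * z) ^ (k * J) * z ^ hdist A B"
      using walks_le[OF S _ _ z, of A B "k * J"] that C J(2) by (auto simp: n_def)
    also have "\<dots> \<le> (2 * n * z) ^ (k * J) * 1"
      using z n by (intro mult_left_mono power_le_one) auto
    finally show ?thesis by simp
  qed
  \<comment> \<open>The exponent z^2 n / 2 in the size hypothesis matches the lower bound on kJ: the
    size of \<open>C\<close> costs at most a factor 2 per step of the walk.\<close>
  have "real (card C) \<le> 2 powr (real (k * J))"
    by (rule order_trans[OF card_C]) (use J(3) in \<open>simp add: n_def\<close>)
  then have card_C': "real (card C) \<le> 2 ^ (k * J)"
    by (subst (asm) powr_realpow) auto
  have a0: "a 0 = (\<Sum>A\<in>C. (v A)\<^sup>2)"
    by (simp add: a_def u_def power2_eq_square)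
  have a1: "a 1 = (\<Sum>A\<in>C. \<Sum>B\<in>C. of_bool (hdist A B = k) * fact k * (v A * v B))"
    by (simp add: a_def u_def M_def sum_distrib_left mult_ac)
  have a0_nonneg: "0 \<le> a 0"
    by (auto simp: a0 intro: sum_nonneg)
  have "a J \<le> (\<Sum>A\<in>C. v A * (\<Sum>D\<in>C. (2 * n * z) ^ (k * J) * v D))"
    unfolding a_def
  proof (rule sum_mono, rule mult_left_mono)
    fix A assume A: "A \<in> C"
    show "u J A \<le> (\<Sum>D\<in>C. (2 * n * z) ^ (k * J) * v D)"
      by (rule order_trans[OF u_le[OF A]], intro sum_mono mult_right_mono G A v)
  qed (rule v)
  also have "\<dots> = (2 * n * z) ^ (k * J) * (\<Sum>A\<in>C. v A * 1)\<^sup>2"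
    by (simp add: power2_eq_square sum_distrib_left sum_distrib_right mult_ac)
  also have "\<dots> \<le> (2 * n * z) ^ (k * J) * (a 0 * real (card C))"
    using Cauchy_Schwarz_ineq_sum[of v "\<lambda>_. 1" C] z n
    by (intro mult_left_mono) (auto simp: a0)
  also have "\<dots> \<le> (2 * n * z) ^ (k * J) * (a 0 * 2 ^ (k * J))"
    using z n card_C' a0_nonneg by (intro mult_left_mono) auto
  also have "\<dots> = a 0 * ((4 * n * z) ^ k) ^ J"
  proof -
    have "(2 * n * z) ^ (k * J) * 2 ^ (k * J) = (2 * n * z * 2) ^ (k * J)"
      by (simp only: power_mult_distrib)
    also have "\<dots> = ((4 * n * z) ^ k) ^ J"
      by (simp only: power_mult[symmetric]) (simp add: mult_ac)
    finally show ?thesis by simp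
  qed
  finally have aJ: "a J \<le> a 0 * ((4 * n * z) ^ k) ^ J" .
  have "a 1 ^ J * a 0 \<le> a 0 ^ J * a J"
    unfolding a_def u_def J_def by (rule power_iteration[OF fin M_sym v M_nonneg])
  also have "\<dots> \<le> a 0 ^ J * (a 0 * ((4 * n * z) ^ k) ^ J)"
    using a0_nonneg by (intro mult_left_mono aJ) auto
  also have "\<dots> = ((4 * n * z) ^ k * a 0) ^ J * a 0"
    by (simp add: power_mult_distrib mult_ac)
  finally have main: "a 1 ^ J * a 0 \<le> ((4 * n * z) ^ k * a 0) ^ J * a 0" .
  have "a 1 \<le> (4 * n * z) ^ k * a 0"
  proof (cases "a 0 = 0")
    case True
    then have "v A = 0" if "A \<in> C" for A
      using that fin by (auto simp: a0 sum_nonneg_eq_0_iff)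
    then show ?thesis
      by (simp add: a_def True)
  next
    case False
    then have "a 0 > 0"
      using a0_nonneg by simp
    then have "a 1 ^ J \<le> ((4 * n * z) ^ k * a 0) ^ J"
      by (rule mult_right_le_imp_le[OF main])
    then show ?thesis
      by (rule power_le_imp_le_base[of _ "J - 1", unfolded Suc_diff_1[OF J(1)]])
        (use z n a0_nonneg J(1) in auto)
  qed
  then show ?thesis
    unfolding a0 a1 n_def .
qed

section \<open>Random maximal chains\<close>

text \<open>Such a permutation splits uniquely into an ordering of \<open>A\<close> and one of
  \<open>S - A\<close>. The predicate \<open>P\<close> on the second part leaves room for the
  condition that the chain also passes through a larger set.\<close>

lemma permutations_of_set_prefix:
  assumes "A \<subseteq> S" "finite S"
  shows "{xs \<in> permutations_of_set S. set (take (card A) xs) = A \<and> P (drop (card A) xs)}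
    = (\<lambda>(xs, ys). xs @ ys) ` (permutations_of_set A \<times> {ys \<in> permutations_of_set (S - A). P ys})"
    (is "?L = ?R")
proof (intro equalityI subsetI)
  fix xs
  assume xs: "xs \<in> ?L"
  let ?a = "take (card A) xs" and ?b = "drop (card A) xs"
  have "distinct (?a @ ?b)" "set (?a @ ?b) = S" "set ?a = A"
    using xs by (simp_all only: append_take_drop_id permutations_of_set_def mem_Collect_eq)
  then have "?a \<in> permutations_of_set A" "?b \<in> permutations_of_set (S - A)"
    unfolding distinct_append set_append permutations_of_set_def by blast+
  then have "(?a, ?b) \<in> permutations_of_set A \<times> {ys \<in> permutations_of_set (S - A). P ys}"
    using xs by auto
  then show "xs \<in> ?R"
    by (rule rev_image_eqI) simp
next
  fix xs
  assume "xs \<in> ?R"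
  then obtain a b where ab: "xs = a @ b" "a \<in> permutations_of_set A"
    "b \<in> permutations_of_set (S - A)" "P b"
    by auto
  then have "length a = card A"
    by (simp add: length_finite_permutations_of_set)
  then show "xs \<in> ?L"
    using ab assms by (auto simp: permutations_of_set_def)
qed

lemma card_permutations_of_set_prefix:
  assumes "A \<subseteq> S" "finite S"
  shows "card {xs \<in> permutations_of_set S. set (take (card A) xs) = A \<and> P (drop (card A) xs)}
    = fact (card A) * card {ys \<in> permutations_of_set (S - A). P ys}"
proof -
  have "finite A"
    using assms finite_subset by blast
  moreover have "inj_on (\<lambda>(xs, ys). xs @ ys)
      (permutations_of_set A \<times> {ys \<in> permutations_of_set (S - A). P ys})"
    by (auto simp: inj_on_def dest!: length_finite_permutations_of_set)
  ultimately show ?thesis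
    unfolding permutations_of_set_prefix[OF assms] by (simp add: card_image card_cartesian_product)
qed

text \<open>
  A maximal chain is represented by the order in which it adds the elements, and it passes through
  $A$ if the elements of $A$ come first.
\<close>

definition chains_through :: "'a set \<Rightarrow> 'a set \<Rightarrow> 'a list set" where
  "chains_through S A = {xs \<in> permutations_of_set S. set (take (card A) xs) = A}"

lemma card_chains_through:
  assumes "A \<subseteq> S" "finite S"
  shows "card (chains_through S A) = fact (card A) * fact (card S - card A)"
  using card_permutations_of_set_prefix[OF assms, of "\<lambda>_. True"] assms
  by (simp add: chains_through_def card_Diff_subset finite_subset)

text \<open>After \<open>A\<close> has been added, the rest of the order is a chain in
  \<open>S - A\<close> that has to pass through \<open>B - A\<close>. The three blocks
  \<open>A\<close>, \<open>B - A\<close> and \<open>S - B\<close> are therefore ordered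
  independently.\<close>

lemma card_chains_through_Int:
  assumes "A \<subseteq> B" "B \<subseteq> S" "finite S"
  shows "card (chains_through S A \<inter> chains_through S B)
    = fact (card A) * (fact (card (B - A)) * fact (card S - card B))"
proof -
  have fin: "finite B" "finite A"
    using finite_subset[OF assms(2,3)] finite_subset[OF assms(1)] by blast+
  have le: "card A \<le> card B"
    using fin(1) assms(1) by (rule card_mono)
  have take: "set (take (card B) xs) = B \<longleftrightarrow> set (take (card (B - A)) (drop (card A) xs)) = B - A"
    if "xs \<in> permutations_of_set S" "set (take (card A) xs) = A" for xs
  proof -
    have "card B = card A + card (B - A)"
      using le fin assms(1) by (simp add: card_Diff_subset)
    then have split: "set (take (card B) xs) = A \<union> set (take (card (B - A)) (drop (card A) xs))"
      by (metis take_add set_append that(2))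
    have "distinct (take (card A) xs @ drop (card A) xs)"
      using that(1) permutations_of_setD(2) by (metis append_take_drop_id)
    then have "A \<inter> set (take (card (B - A)) (drop (card A) xs)) = {}"
      unfolding distinct_append that(2) using set_take_subset by fastforce
    then show ?thesis
      unfolding split using assms(1) by blast
  qed
  have "chains_through S A \<inter> chains_through S B = {xs \<in> permutations_of_set S.
      set (take (card A) xs) = A \<and> set (take (card (B - A)) (drop (card A) xs)) = B - A}"
    using take by (auto simp: chains_through_def)
  then have "card (chains_through S A \<inter> chains_through S B)
      = fact (card A) * card (chains_through (S - A) (B - A))"
    using card_permutations_of_set_prefix[of A S "\<lambda>ys. set (take (card (B - A)) ys) = B - A"] assms
    by (simp add: chains_through_def)
  also have "card (chains_through (S - A) (B - A)) = fact (card (B - A)) * fact (card S - card B)"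
    using assms fin le card_mono[OF assms(3,2)]
    by (subst card_chains_through) (auto simp: card_Diff_subset)
  finally show ?thesis .
qed

lemma chains_through_linear:
  assumes "xs \<in> chains_through S A" "xs \<in> chains_through S B"
  shows "A \<subseteq> B \<or> B \<subseteq> A"
proof -
  have "A = set (take (card A) xs)" "B = set (take (card B) xs)"
    using assms by (auto simp: chains_through_def)
  then show ?thesis
    by (metis nat_le_linear set_take_subset_set_take)
qed

text \<open>A minimal member of a chain lies strictly below all the others, so the pairs containing
  it already number |X| - 1.\<close>

lemma card_family_le_pairs:
  assumes "finite X" "\<And>A B. A \<in> X \<Longrightarrow> B \<in> X \<Longrightarrow> A \<subseteq> B \<or> B \<subseteq> A"
  shows "card X \<le> 1 + card {(A, B). A \<in> X \<and> B \<in> X \<and> A \<subset> B}"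
proof (cases "X = {}")
  case False
  have fin: "finite {(A, B). A \<in> X \<and> B \<in> X \<and> A \<subset> B}"
    by (rule finite_subset[of _ "X \<times> X"]) (use assms in auto)
  obtain A where A: "A \<in> X" "\<And>B. B \<in> X \<Longrightarrow> B \<subseteq> A \<Longrightarrow> A = B"
    using finite_has_minimal[OF assms(1) False] by auto
  then have "(\<lambda>B. (A, B)) ` (X - {A}) \<subseteq> {(A, B). A \<in> X \<and> B \<in> X \<and> A \<subset> B}"
    using assms(2) by fastforce
  then have "card ((\<lambda>B. (A, B)) ` (X - {A})) \<le> card {(A, B). A \<in> X \<and> B \<in> X \<and> A \<subset> B}"
    using fin card_mono by blast
  then have "card (X - {A}) \<le> card {(A, B). A \<in> X \<and> B \<in> X \<and> A \<subset> B}"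
    by (subst (asm) card_image) (auto simp: inj_on_def)
  then show ?thesis
    using A(1) assms(1) by (simp add: card_Diff_singleton)
qed simp

text \<open>Double counting: \<open>card_family_le_pairs\<close> is applied to the members of
  \<open>F\<close> on each maximal chain and summed over all n! chains. Everything is scaled by n!,
  so it stays in the natural numbers.\<close>

lemma LYM_pairs:
  assumes S: "finite S" and F: "F \<subseteq> Pow S"
  shows "(\<Sum>A\<in>F. card (chains_through S A))
    \<le> fact (card S) + (\<Sum>A\<in>F. \<Sum>B\<in>{B \<in> F. A \<subset> B}. card (chains_through S A \<inter> chains_through S B))"
proof -
  let ?P = "permutations_of_set S" and ?c = "chains_through S"
  let ?X = "\<lambda>xs. {A \<in> F. xs \<in> ?c A}"
  have fin: "finite F"
    using S F finite_subset by (metis finite_Pow_iff)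
  have sub: "?c A \<subseteq> ?P" for A
    by (auto simp: chains_through_def)
  have card_eq: "card Y = (\<Sum>xs\<in>?P. of_bool (xs \<in> Y))" if "Y \<subseteq> ?P" for Y
  proof -
    have "{xs \<in> ?P. xs \<in> Y} = Y"
      using that by auto
    then show ?thesis
      by (simp add: of_bool_def sum.If_cases Int_def)
  qed
  have step: "(\<Sum>A\<in>F. of_bool (xs \<in> ?c A))
      \<le> 1 + (\<Sum>A\<in>F. \<Sum>B\<in>{B \<in> F. A \<subset> B}. of_bool (xs \<in> ?c A \<inter> ?c B) :: nat)" for xs
  proof -
    have "(\<Sum>A\<in>F. of_bool (xs \<in> ?c A)) = card (?X xs)"
      using fin by (simp add: of_bool_def sum.If_cases Int_def)
    also have "\<dots> \<le> 1 + card {(A, B). A \<in> ?X xs \<and> B \<in> ?X xs \<and> A \<subset> B}"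
      using fin chains_through_linear by (intro card_family_le_pairs) (simp, blast)
    also have "{(A, B). A \<in> ?X xs \<and> B \<in> ?X xs \<and> A \<subset> B}
        = (SIGMA A:F. {B \<in> F. A \<subset> B}) \<inter> {(A, B). xs \<in> ?c A \<inter> ?c B}"
      by auto
    also have "card \<dots> = (\<Sum>(A, B)\<in>(SIGMA A:F. {B \<in> F. A \<subset> B}). of_bool (xs \<in> ?c A \<inter> ?c B))"
      using fin by (simp add: of_bool_def sum.If_cases case_prod_unfold)
    also have "\<dots> = (\<Sum>A\<in>F. \<Sum>B\<in>{B \<in> F. A \<subset> B}. of_bool (xs \<in> ?c A \<inter> ?c B))"
      using fin by (subst sum.Sigma) auto
    finally show ?thesis .
  qed
  have "(\<Sum>A\<in>F. card (?c A)) = (\<Sum>xs\<in>?P. \<Sum>A\<in>F. of_bool (xs \<in> ?c A))"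
    by (subst sum.swap) (simp add: card_eq[OF sub])
  also have "\<dots> \<le> (\<Sum>xs\<in>?P. 1 + (\<Sum>A\<in>F. \<Sum>B\<in>{B \<in> F. A \<subset> B}. of_bool (xs \<in> ?c A \<inter> ?c B)))"
    by (intro sum_mono step)
  also have "\<dots> = fact (card S) + (\<Sum>xs\<in>?P. \<Sum>A\<in>F. \<Sum>B\<in>{B \<in> F. A \<subset> B}. of_bool (xs \<in> ?c A \<inter> ?c B))"
    using S by (subst sum.distrib) simp
  also have "(\<Sum>xs\<in>?P. \<Sum>A\<in>F. \<Sum>B\<in>{B \<in> F. A \<subset> B}. of_bool (xs \<in> ?c A \<inter> ?c B))
      = (\<Sum>A\<in>F. \<Sum>B\<in>{B \<in> F. A \<subset> B}. \<Sum>xs\<in>?P. of_bool (xs \<in> ?c A \<inter> ?c B))"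
    by (subst sum.swap, rule sum.cong[OF refl], rule sum.swap)
  also have "\<dots> = (\<Sum>A\<in>F. \<Sum>B\<in>{B \<in> F. A \<subset> B}. card (?c A \<inter> ?c B))"
    using sub by (intro sum.cong refl card_eq[symmetric]) auto
  finally show ?thesis .
qed

section \<open>Families near the middle level\<close>

text \<open>The quotient (m + k)! / m! is a product of k factors, each at least m + 1 and hence at
  least x.\<close>

lemma fact_times_power_le:
  fixes x :: real
  assumes "0 \<le> x" "x \<le> real m + 1"
  shows "fact m * x ^ k \<le> fact (m + k)"
proof (induction k)
  case (Suc k)
  have "fact m * x ^ Suc k = x * (fact m * x ^ k)"
    by simp
  also have "\<dots> \<le> real (m + k + 1) * fact (m + k)"
    using assms Suc.IH by (intro mult_mono) auto
  finally show ?case by simp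
qed simp

text \<open>With a = |A|, b = n - |B| and k = |B - A|, the three counts are a! (b + k)!, (a + k)! b!
  and a! k! b!. Both a and b are at least n/4, so raising either factorial by k gains at least
  (n/4)^k. The geometric mean puts the bound in the form v(A) v(B) required by
  \<open>sum_hdist_le\<close>.\<close>

lemma card_chains_through_Int_le:
  assumes S: "finite S" and AB: "A \<subset> B" "B \<subseteq> S"
    and A: "real (card S) / 4 \<le> real (card A)" and B: "real (card B) \<le> 3 * real (card S) / 4"
  shows "real (card (chains_through S A \<inter> chains_through S B))
    \<le> (4 / real (card S)) ^ card (B - A) * (fact (card (B - A)) *
        (sqrt (real (card (chains_through S A))) * sqrt (real (card (chains_through S B)))))"
proof -
  define a b k and x :: real
    where "a = card A" "b = card S - card B" "k = card (B - A)" "x = real (card S) / 4"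
  note d = this
  have fin: "finite B" "finite A"
    using finite_subset[OF AB(2) S] finite_subset[of A B] AB(1) by auto
  have card_B: "card B = a + k"
    using card_mono[OF fin(1), of A] fin AB by (auto simp: d card_Diff_subset)
  have card_S: "card S = a + k + b"
    using card_mono[OF S AB(2)] by (simp add: card_B d(2))
  have AS: "A \<subseteq> S"
    using AB by blast
  have cards: "card A = a" "card B = a + k" "card (B - A) = k"
    by (simp_all only: d card_B)
  have diffs: "card S - a = b + k" "card S - (a + k) = b"
    by (simp_all add: card_S)
  have x: "0 < x" "x \<le> real a + 1" "x \<le> real b + 1"
    using A B psubset_card_mono[OF fin(1) AB(1)] card_B card_S by (auto simp: d(4) d(1))
  \<comment> \<open>Squaring supplies one power x^k for each of the two factorials to be
    raised.\<close>
  have "(fact a * fact b * x ^ k)\<^sup>2 = fact a * fact b * ((fact a * x ^ k) * (fact b * x ^ k))"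
    by (simp add: power2_eq_square mult_ac)
  also have "\<dots> \<le> fact a * fact b * (fact (a + k) * fact (b + k))"
    using x by (intro mult_left_mono mult_mono fact_times_power_le) auto
  also have "\<dots> = (fact a * fact (b + k)) * (fact (a + k) * fact b)"
    by (simp add: mult_ac)
  finally have "fact a * fact b * x ^ k \<le> sqrt ((fact a * fact (b + k)) * (fact (a + k) * fact b))"
    by (rule real_le_rsqrt)
  then have "fact a * fact b \<le> (1 / x) ^ k * (sqrt (fact a * fact (b + k)) * sqrt (fact (a + k) * fact b))"
    using x(1) by (simp add: real_sqrt_mult power_one_over field_simps)
  then have "fact k * (fact a * fact b)
      \<le> fact k * ((1 / x) ^ k * (sqrt (fact a * fact (b + k)) * sqrt (fact (a + k) * fact b)))"
    by (rule mult_left_mono) simp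
  moreover have "1 / x = 4 / real (card S)"
    by (simp add: d(4))
  moreover have "card (chains_through S A) = fact a * fact (b + k)"
    unfolding card_chains_through[OF AS S] cards diffs ..
  moreover have "card (chains_through S B) = fact (a + k) * fact b"
    unfolding card_chains_through[OF AB(2) S] cards diffs ..
  moreover have "card (chains_through S A \<inter> chains_through S B) = fact a * (fact k * fact b)"
    unfolding card_chains_through_Int[OF psubset_imp_subset[OF AB(1)] AB(2) S] cards diffs ..
  ultimately show ?thesis
    unfolding cards by (simp add: mult_ac)
qed

lemma sum_power_le:
  fixes y :: real
  assumes "0 \<le> y" "y \<le> 1 / 2"
  shows "(\<Sum>k\<in>{1..K}. y ^ k) \<le> 2 * y"
proof -
  \<comment> \<open>The subtracted term makes the bound inductive.\<close>
  have "(\<Sum>k\<in>{1..K}. y ^ k) \<le> 2 * y - 2 * y ^ Suc K"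
  proof (induction K)
    case (Suc K)
    have "2 * (y * y ^ Suc K) \<le> 1 * y ^ Suc K"
      using assms mult_right_mono[of "2 * y" 1 "y ^ Suc K"] by simp
    then show ?case
      using Suc by simp
  qed simp
  then show ?thesis
    using assms zero_le_power[of y "Suc K"] by linarith
qed

text \<open>Pairs are sorted by distance k. The factor (4/n)^k from the chain counts and (4nz)^k
  from \<open>sum_hdist_le\<close> multiply to (16z)^k. As z \<le> 1/32, this geometric series has
  ratio at most 1/2 and sum at most 32z.\<close>

lemma sum_comparable_pairs_le:
  assumes S: "finite S" and C: "C \<subseteq> Pow S" and z: "0 < z" "z \<le> 1 / 32"
    and card_C: "real (card C) \<le> 2 powr (z\<^sup>2 * real (card S) / 2)"
    and mid: "\<And>A. A \<in> C \<Longrightarrow> \<bar>real (card A) - real (card S) / 2\<bar> \<le> z\<^sup>2 * real (card S) / 2"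
  shows "(\<Sum>A\<in>C. \<Sum>B\<in>{B \<in> C. A \<subset> B}. real (card (chains_through S A \<inter> chains_through S B)))
    \<le> 32 * z * (\<Sum>A\<in>C. real (card (chains_through S A)))"
proof -
  let ?N = "\<lambda>A. real (card (chains_through S A))"
  let ?n = "real (card S)"
  define K where "K = nat \<lfloor>z\<^sup>2 * ?n\<rfloor>"
  define f where "f k A B = (4 / ?n) ^ k * (of_bool (hdist A B = k) * fact k * (sqrt (?N A) * sqrt (?N B)))"
    for k A B
  have fin: "finite C"
    using S C finite_subset by (metis finite_Pow_iff)
  have f_nonneg: "0 \<le> f k A B" for k A B
    by (simp add: f_def)
  have "z\<^sup>2 \<le> 1 / 2"
    using z power_mono[of z "1 / 32" 2] by (simp add: power2_eq_square)
  then have "z\<^sup>2 * ?n \<le> 1 / 2 * ?n"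
    by (rule mult_right_mono) simp
  then have z2n: "z\<^sup>2 * ?n / 2 \<le> ?n / 4"
    by linarith
  have pair: "real (card (chains_through S A \<inter> chains_through S B)) \<le> (\<Sum>k\<in>{1..K}. f k A B)"
    if AB: "A \<in> C" "B \<in> C" "A \<subset> B" for A B
  proof -
    have fin_B: "finite B" "finite A"
      using AB C S finite_subset by blast+
    have dist: "hdist A B = card (B - A)"
      using AB(3) by (intro hdist_subset) auto
    have "card A < card B"
      using fin_B AB(3) by (simp add: psubset_card_mono)
    moreover have "card (B - A) = card B - card A"
      using fin_B AB(3) by (simp add: card_Diff_subset psubset_imp_subset)
    \<comment> \<open>Both sizes are within z^2 n / 2 of n/2, so only distances in the range allowed
      by \<open>sum_hdist_le\<close> occur.\<close>
    moreover have "real (card B) - real (card A) \<le> z\<^sup>2 * ?n"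
      using mid[OF AB(1)] mid[OF AB(2)] by linarith
    ultimately have "card (B - A) \<in> {1..K}"
      by (auto simp: K_def le_nat_floor)
    then have "f (card (B - A)) A B \<le> (\<Sum>k\<in>{1..K}. f k A B)"
      by (intro member_le_sum) (auto simp: f_nonneg)
    moreover have "B \<subseteq> S" "?n / 4 \<le> real (card A)" "real (card B) \<le> 3 * ?n / 4"
      using AB C mid[OF AB(1)] mid[OF AB(2)] z2n by (blast, linarith+)
    then have "real (card (chains_through S A \<inter> chains_through S B)) \<le> f (card (B - A)) A B"
      using card_chains_through_Int_le[OF S AB(3)] by (simp add: f_def dist)
    ultimately show ?thesis by linarith
  qed
  have dist_k: "(\<Sum>A\<in>C. \<Sum>B\<in>C. f k A B) \<le> (16 * z) ^ k * (\<Sum>A\<in>C. ?N A)" if k: "k \<in> {1..K}" for k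
  proof -
    have "0 < K"
      using k by auto
    then have "?n \<noteq> 0"
      by (intro notI) (simp add: K_def)
    have "real k \<le> real K" "real K \<le> z\<^sup>2 * ?n"
      using k z by (auto simp: K_def)
    then have kz: "real k \<le> z\<^sup>2 * ?n"
      by linarith
    have "(\<Sum>A\<in>C. \<Sum>B\<in>C. f k A B) = (4 / ?n) ^ k *
        (\<Sum>A\<in>C. \<Sum>B\<in>C. of_bool (hdist A B = k) * fact k * (sqrt (?N A) * sqrt (?N B)))"
      by (simp only: f_def sum_distrib_left)
    also have "\<dots> \<le> (4 / ?n) ^ k * ((4 * ?n * z) ^ k * (\<Sum>A\<in>C. (sqrt (?N A))\<^sup>2))"
      using z k by (intro mult_left_mono sum_hdist_le S C card_C kz) auto
    also have "\<dots> = (4 / ?n * (4 * ?n * z)) ^ k * (\<Sum>A\<in>C. ?N A)"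
      by (simp only: power_mult_distrib mult.assoc real_sqrt_pow2[OF of_nat_0_le_iff])
    also have "4 / ?n * (4 * ?n * z) = 16 * z"
      using \<open>?n \<noteq> 0\<close> by simp
    finally show ?thesis .
  qed
  have "(\<Sum>A\<in>C. \<Sum>B\<in>{B \<in> C. A \<subset> B}. real (card (chains_through S A \<inter> chains_through S B)))
      \<le> (\<Sum>A\<in>C. \<Sum>B\<in>{B \<in> C. A \<subset> B}. \<Sum>k\<in>{1..K}. f k A B)"
    by (intro sum_mono pair) auto
  \<comment> \<open>Nonnegativity allows comparability to be dropped, which yields the full
    quadratic form of a symmetric matrix.\<close>
  also have "\<dots> \<le> (\<Sum>A\<in>C. \<Sum>B\<in>C. \<Sum>k\<in>{1..K}. f k A B)"
    using fin by (intro sum_mono sum_mono2) (auto intro!: sum_nonneg f_nonneg)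
  also have "\<dots> = (\<Sum>A\<in>C. \<Sum>k\<in>{1..K}. \<Sum>B\<in>C. f k A B)"
    by (intro sum.cong refl sum.swap)
  also have "\<dots> = (\<Sum>k\<in>{1..K}. \<Sum>A\<in>C. \<Sum>B\<in>C. f k A B)"
    by (rule sum.swap)
  also have "\<dots> \<le> (\<Sum>k\<in>{1..K}. (16 * z) ^ k * (\<Sum>A\<in>C. ?N A))"
    by (intro sum_mono dist_k)
  also have "\<dots> = (\<Sum>k\<in>{1..K}. (16 * z) ^ k) * (\<Sum>A\<in>C. ?N A)"
    by (simp only: sum_distrib_right)
  also have "\<dots> \<le> (2 * (16 * z)) * (\<Sum>A\<in>C. ?N A)"
    using z by (intro mult_right_mono sum_power_le sum_nonneg) auto
  finally show ?thesis by simp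
qed

text \<open>
  The function $c$ labels the components: comparable members have equal labels.
\<close>

lemma card_family_le:
  assumes S: "finite S" and F: "F \<subseteq> Pow S" and z: "0 < z" "z \<le> 1 / 32"
    and comp: "\<And>A B. A \<in> F \<Longrightarrow> B \<in> F \<Longrightarrow> A \<subset> B \<Longrightarrow> c A = c B"
    and card_C: "\<And>A. A \<in> F \<Longrightarrow> real (card {B \<in> F. c B = c A}) \<le> 2 powr (z\<^sup>2 * real (card S) / 2)"
    and mid: "\<And>A. A \<in> F \<Longrightarrow> \<bar>real (card A) - real (card S) / 2\<bar> \<le> z\<^sup>2 * real (card S) / 2"
  shows "(1 - 32 * z) * real (card F) \<le> real (card S choose (card S div 2))"
proof -
  let ?n = "card S"
  let ?N = "\<lambda>A. real (card (chains_through S A))"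
  let ?N2 = "\<lambda>A B. real (card (chains_through S A \<inter> chains_through S B))"
  let ?m = "real (?n choose (?n div 2))"
  have fin: "finite F"
    using S F finite_subset by (metis finite_Pow_iff)
  have "(\<Sum>A\<in>F. \<Sum>B\<in>{B \<in> F. A \<subset> B}. ?N2 A B)
      = (\<Sum>x\<in>c ` F. \<Sum>A\<in>{A \<in> F. c A = x}. \<Sum>B\<in>{B \<in> F. A \<subset> B}. ?N2 A B)"
    using fin by (intro sum.image_gen)
  also have "\<dots> = (\<Sum>x\<in>c ` F. \<Sum>A\<in>{A \<in> F. c A = x}.
      \<Sum>B\<in>{B \<in> {A \<in> F. c A = x}. A \<subset> B}. ?N2 A B)"
  proof (intro sum.cong refl)
    fix x A assume "A \<in> {A \<in> F. c A = x}"
    then show "{B \<in> F. A \<subset> B} = {B \<in> {A \<in> F. c A = x}. A \<subset> B}"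
      by (intro Collect_cong) (metis (mono_tags, lifting) comp mem_Collect_eq)
  qed
  also have "\<dots> \<le> (\<Sum>x\<in>c ` F. 32 * z * (\<Sum>A\<in>{A \<in> F. c A = x}. ?N A))"
  proof (intro sum_mono sum_comparable_pairs_le S z)
    fix x assume "x \<in> c ` F"
    then show "real (card {A \<in> F. c A = x}) \<le> 2 powr (z\<^sup>2 * real ?n / 2)"
      using card_C by blast
  qed (use F mid in blast)+
  also have "\<dots> = 32 * z * (\<Sum>x\<in>c ` F. \<Sum>A\<in>{A \<in> F. c A = x}. ?N A)"
    by (simp only: sum_distrib_left)
  also have "(\<Sum>x\<in>c ` F. \<Sum>A\<in>{A \<in> F. c A = x}. ?N A) = (\<Sum>A\<in>F. ?N A)"
    using fin by (rule sum.image_gen[symmetric])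
  finally have pairs: "(\<Sum>A\<in>F. \<Sum>B\<in>{B \<in> F. A \<subset> B}. ?N2 A B) \<le> 32 * z * (\<Sum>A\<in>F. ?N A)" .
  have "(\<Sum>A\<in>F. ?N A) \<le> fact ?n + (\<Sum>A\<in>F. \<Sum>B\<in>{B \<in> F. A \<subset> B}. ?N2 A B)"
    using LYM_pairs[OF S F, THEN of_nat_mono[where 'a = real]] by simp
  \<comment> \<open>The pair sum is a small multiple of the LYM sum itself and is absorbed on the
    left.\<close>
  with pairs have total: "(1 - 32 * z) * (\<Sum>A\<in>F. ?N A) \<le> fact ?n"
    by (simp add: algebra_simps)
  \<comment> \<open>The ratio n! / N(A) is the binomial coefficient of |A|, hence at most the
    central one.\<close>
  have "fact ?n \<le> ?N A * ?m" if "A \<in> F" for A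
  proof -
    have A: "A \<subseteq> S"
      using that F by auto
    have "fact ?n = card (chains_through S A) * (?n choose card A)"
      using binomial_fact_lemma[OF card_mono[OF S A]] by (simp add: card_chains_through[OF A S])
    also have "\<dots> \<le> card (chains_through S A) * (?n choose (?n div 2))"
      by (intro mult_left_mono binomial_maximum) simp
    finally show ?thesis
      by (metis of_nat_fact of_nat_le_iff of_nat_mult)
  qed
  then have "real (card F) * fact ?n \<le> (\<Sum>A\<in>F. ?N A * ?m)"
    using sum_mono[of F "\<lambda>_. fact ?n" "\<lambda>A. ?N A * ?m"] by simp
  then have "(1 - 32 * z) * (real (card F) * fact ?n) \<le> (1 - 32 * z) * ((\<Sum>A\<in>F. ?N A) * ?m)"
    using z by (intro mult_left_mono) (auto simp: sum_distrib_right)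
  also have "\<dots> \<le> fact ?n * ?m"
    using mult_right_mono[OF total, of ?m] by (simp add: mult_ac)
  finally have "((1 - 32 * z) * real (card F)) * fact ?n \<le> ?m * fact ?n"
    by (simp add: mult_ac)
  then show ?thesis
    by (rule mult_right_le_imp_le) simp
qed

text \<open>The size of a uniformly random subset is binomial with parameter 1/2, so this is
  Hoeffding's inequality (\<open>prob_abs_ge\<close>) multiplied by 2^n.\<close>

lemma card_unbalanced_subsets_le:
  fixes \<epsilon> :: real
  assumes S: "finite S" "S \<noteq> {}" and \<epsilon>: "0 \<le> \<epsilon>"
  shows "real (card {A \<in> Pow S. \<epsilon> \<le> \<bar>real (card A) - real (card S) / 2\<bar>})
    \<le> 2 ^ card S * (2 * exp (- 2 * \<epsilon>\<^sup>2 / real (card S)))"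
proof -
  let ?n = "card S"
  define I where "I = {i \<in> {..?n}. \<epsilon> \<le> \<bar>real i - real ?n / 2\<bar>}"
  define T where "T = {A \<in> Pow S. \<epsilon> \<le> \<bar>real (card A) - real ?n / 2\<bar>}"
  interpret binomial_distribution ?n "1 / 2"
    by unfold_locales simp
  have n: "0 < ?n"
    using S by (simp add: card_gt_0_iff)
  have "card T = (\<Sum>i\<in>I. \<Sum>A\<in>{A \<in> T. card A = i}. 1)"
    using S(1) by (subst sum.group) (auto simp: T_def I_def card_mono)
  also have "\<dots> = (\<Sum>i\<in>I. ?n choose i)"
  proof (intro sum.cong refl)
    fix i assume "i \<in> I"
    then have "{A \<in> T. card A = i} = {A. A \<subseteq> S \<and> card A = i}"
      by (auto simp: T_def I_def)
    then show "(\<Sum>A\<in>{A \<in> T. card A = i}. 1) = ?n choose i"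
      using n_subsets[OF S(1)] by simp
  qed
  finally have "real (card T) = (\<Sum>i\<in>I. real (?n choose i))"
    by simp
  also have "\<dots> = (\<Sum>i\<in>I. 2 ^ ?n * pmf (binomial_pmf ?n (1 / 2)) i)"
  proof (intro sum.cong refl)
    fix i assume "i \<in> I"
    then have "i \<le> ?n" by (simp add: I_def)
    then have "(2 :: real) ^ ?n = 2 ^ i * 2 ^ (?n - i)"
      by (simp flip: power_add)
    then show "real (?n choose i) = 2 ^ ?n * pmf (binomial_pmf ?n (1 / 2)) i"
      by (simp add: power_one_over)
  qed
  also have "\<dots> = 2 ^ ?n * measure_pmf.prob (binomial_pmf ?n (1 / 2)) I"
    by (simp add: measure_measure_pmf_finite I_def sum_distrib_left)
  also have "\<dots> \<le> 2 ^ ?n * measure_pmf.prob (binomial_pmf ?n (1 / 2)) {x. \<epsilon> \<le> \<bar>real x - real ?n * (1 / 2)\<bar>}"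
    by (intro mult_left_mono measure_pmf.finite_measure_mono) (auto simp: I_def)
  also have "\<dots> \<le> 2 ^ ?n * (2 * exp (- 2 * \<epsilon>\<^sup>2 / real ?n))"
    by (intro mult_left_mono prob_abs_ge n \<epsilon>) auto
  finally show ?thesis
    by (simp add: T_def)
qed

section \<open>Components and asymptotics\<close>

text \<open>The label of a set is its strongly connected component. Comparable sets are joined by
  arcs in both directions and so share it; each label class lies inside the component that labels
  it.\<close>

lemma components_le_classes:
  assumes "finite F" "components_le t F"
  obtains c :: "nat set \<Rightarrow> nat set set"
  where "\<And>A B. A \<in> F \<Longrightarrow> B \<in> F \<Longrightarrow> A \<subset> B \<Longrightarrow> c A = c B"
    and "\<And>A. A \<in> F \<Longrightarrow> card {B \<in> F. c B = c A} \<le> t"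
proof
  interpret pair_graph "comp_graph F"
    using assms(1) by (rule pair_graph_comp_graph)
  have verts: "verts (with_proj (comp_graph F)) = F"
    by (simp add: comp_graph_def)
  show "scc_of A = scc_of B" if "A \<in> F" "B \<in> F" "A \<subset> B" for A B
  proof (rule scc_of_eq)
    have "(A, B) \<in> parcs (comp_graph F)" "(B, A) \<in> parcs (comp_graph F)"
      using that by (auto simp: comp_graph_def)
    then show "A \<in> scc_of B"
      by (auto simp: scc_of_def intro: reachable_adjI)
  qed
  show "card {B \<in> F. scc_of B = scc_of A} \<le> t" if "A \<in> F" for A
  proof -
    have scc: "scc_of A \<in> sccs_verts"
      using that verts by (intro scc_of_in_sccs_verts) simp
    have "{B \<in> F. scc_of B = scc_of A} \<subseteq> scc_of A"
    proof
      fix B assume "B \<in> {B \<in> F. scc_of B = scc_of A}"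
      then show "B \<in> scc_of A"
        using in_scc_of_self[of B] verts by simp
    qed
    moreover have "finite (scc_of A)"
      using sccs_verts_subsets[OF scc] assms(1) by (simp add: comp_graph_def finite_subset)
    ultimately have "card {B \<in> F. scc_of B = scc_of A} \<le> card (scc_of A)"
      by (rule card_mono[rotated])
    also have "\<dots> \<le> t"
      using assms scc by (simp add: components_le_iff)
    finally show ?thesis .
  qed
qed

text \<open>Without arcs every component is a single vertex. This gives the lower bound from the
  middle level.\<close>

lemma components_le_antichain:
  assumes "finite F" "0 < t" "\<And>A B. A \<in> F \<Longrightarrow> B \<in> F \<Longrightarrow> A \<subseteq> B \<Longrightarrow> A = B"
  shows "components_le t F"
  unfolding components_le_iff[OF assms(1)]
proof
  interpret pair_graph "comp_graph F"
    using assms(1) by (rule pair_graph_comp_graph)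
  fix X assume "X \<in> sccs_verts"
  then obtain A where X: "X = scc_of A"
    by (auto simp: sccs_verts_conv_scc_of)
  have no_arcs: "parcs (comp_graph F) = {}"
    using assms(3) by (auto simp: comp_graph_def)
  have "B = A" if "A \<rightarrow>\<^sup>*\<^bsub>with_proj (comp_graph F)\<^esub> B" for B
    using that by (induction rule: reachable_induct) (auto simp: no_arcs)
  then have "X \<subseteq> {A}"
    by (auto simp: X scc_of_def)
  then have "card X \<le> card {A}"
    by (intro card_mono) auto
  then show "card X \<le> t"
    using assms(2) by simp
qed

lemma central_binomial_le_La:
  assumes "0 < t"
  shows "n choose (n div 2) \<le> La n t"
proof -
  define F where "F = {A. A \<subseteq> {1..n} \<and> card A = n div 2}"
  have F: "F \<subseteq> Pow {1..n}"
    by (auto simp: F_def)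
  then have fin: "finite F"
    by (rule finite_subset) simp
  have "components_le t F"
    using fin assms
  proof (rule components_le_antichain)
    show "A = B" if "A \<in> F" "B \<in> F" "A \<subseteq> B" for A B
      using that card_subset_eq[of B A] finite_subset[of B "{1..n}"] by (auto simp: F_def)
  qed
  then have "card F \<le> La n t"
    unfolding La_def using F by (intro Max_ge[OF La_set_finite]) auto
  moreover have "card F = n choose (n div 2)"
    using n_subsets[of "{1..n}"] by (simp add: F_def)
  ultimately show ?thesis by simp
qed

text \<open>An extremal family is split into its members near the middle, handled by
  \<open>card_family_le\<close>, and the rest, handled by the tail bound.\<close>

lemma La_le:
  assumes n: "0 < n" and z: "0 < z" "z < 1 / 32" and t: "real t \<le> 2 powr (z\<^sup>2 * real n / 2)"
  shows "real (La n t) \<le> real (n choose (n div 2)) / (1 - 32 * z)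
    + 2 ^ n * (2 * exp (- 2 * (z\<^sup>2 * real n / 2)\<^sup>2 / real n))"
proof -
  let ?\<epsilon> = "z\<^sup>2 * real n / 2"
  have "La n t \<in> {card F | F. F \<subseteq> Pow {1..n} \<and> components_le t F}"
    unfolding La_def using components_le_empty by (intro Max_in La_set_finite) auto
  then obtain F where F: "La n t = card F" "F \<subseteq> Pow {1..n}" "components_le t F"
    by auto
  have fin: "finite F"
    using F(2) by (rule finite_subset) simp
  obtain c :: "nat set \<Rightarrow> nat set set"
    where c: "\<And>A B. A \<in> F \<Longrightarrow> B \<in> F \<Longrightarrow> A \<subset> B \<Longrightarrow> c A = c B"
      "\<And>A. A \<in> F \<Longrightarrow> card {B \<in> F. c B = c A} \<le> t"
    using components_le_classes[OF fin F(3)] by blast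
  define M where "M = {A \<in> F. \<bar>real (card A) - real n / 2\<bar> \<le> ?\<epsilon>}"
  define T where "T = {A \<in> Pow {1..n}. ?\<epsilon> \<le> \<bar>real (card A) - real n / 2\<bar>}"
  have fin_M: "finite M"
    using fin by (simp add: M_def)
  have fin_T: "finite T"
    by (simp add: T_def)
  have "F \<subseteq> M \<union> T"
    using F(2) by (auto simp: M_def T_def)
  then have "card F \<le> card (M \<union> T)"
    using fin_M fin_T by (intro card_mono) auto
  also have "\<dots> \<le> card M + card T"
    by (rule card_Un_le)
  finally have "real (card F) \<le> real (card M) + real (card T)"
    by linarith
  moreover have "(1 - 32 * z) * real (card M) \<le> real (n choose (n div 2))"
  proof -
    have "(1 - 32 * z) * real (card M) \<le> real (card {1..n} choose (card {1..n} div 2))"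
    \<comment> \<open>The labels are still those of the whole family \<open>F\<close>: restriction
      to \<open>M\<close> only shrinks the classes.\<close>
    proof (rule card_family_le[of _ _ _ c])
      fix A assume A: "A \<in> M"
      then have "card {B \<in> M. c B = c A} \<le> card {B \<in> F. c B = c A}"
        using fin by (intro card_mono) (auto simp: M_def)
      also have "\<dots> \<le> t"
        using A c(2) by (simp add: M_def)
      finally have "real (card {B \<in> M. c B = c A}) \<le> real t"
        by simp
      then show "real (card {B \<in> M. c B = c A}) \<le> 2 powr (z\<^sup>2 * real (card {1..n}) / 2)"
        using t by simp
    qed (use F(2) z c(1) in \<open>auto simp: M_def\<close>)
    then show ?thesis by simp
  qed
  then have "real (card M) \<le> real (n choose (n div 2)) / (1 - 32 * z)"
    using z by (simp add: pos_le_divide_eq mult.commute)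
  moreover have "real (card T) \<le> 2 ^ n * (2 * exp (- 2 * ?\<epsilon>\<^sup>2 / real n))"
    using card_unbalanced_subsets_le[of "{1..n}" ?\<epsilon>] n by (simp add: T_def)
  ultimately show ?thesis
    using F(1) by linarith
qed

section \<open>Asymptotics\<close>

lemma two_power_le_central_binomial: "2 ^ n \<le> (n + 1) * (n choose (n div 2))"
proof -
  have "2 ^ n = (\<Sum>k\<le>n. n choose k)"
    by (simp add: choose_row_sum)
  also have "\<dots> \<le> (\<Sum>k\<le>n. n choose (n div 2))"
    by (intro sum_mono binomial_maximum)
  finally show ?thesis by simp
qed

text \<open>For n \<ge> 2 the logarithm is at least 1, so g = o(n). Half of the exponent \<eta> n
  absorbs g and the other half absorbs the constant of the O-bound.\<close>

lemma eventually_subexponential: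
  fixes g :: "nat \<Rightarrow> real" and t :: "nat \<Rightarrow> nat"
  assumes g: "g \<in> o(\<lambda>n. real n / log 2 (real n))"
    and t: "(\<lambda>n. real (t n)) \<in> O(\<lambda>n. 2 powr g n)" and \<eta>: "0 < \<eta>"
  shows "\<forall>\<^sub>F n in sequentially. real (t n) \<le> 2 powr (\<eta> * real n)"
proof -
  obtain C where C: "0 < C" "\<forall>\<^sub>F n in sequentially. norm (real (t n)) \<le> C * norm (2 powr g n)"
    using landau_o.bigE[OF t] by blast
  have "\<forall>\<^sub>F n in sequentially. norm (g n) \<le> \<eta> / 2 * norm (real n / log 2 (real n))"
    using landau_o.smallD[OF g, of "\<eta> / 2"] \<eta> by simp
  moreover have "\<forall>\<^sub>F n in sequentially. C \<le> 2 powr (\<eta> / 2 * real n)"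
    using \<eta> by real_asymp
  ultimately show ?thesis
    using C(2) eventually_ge_at_top[of 2]
  proof eventually_elim
    case (elim n)
    have "1 \<le> log 2 (real n)"
      using elim(4) by (simp add: le_log_iff)
    then have "norm (real n / log 2 (real n)) \<le> real n"
      by (simp add: divide_le_eq mult_le_cancel_left1)
    then have "\<eta> / 2 * norm (real n / log 2 (real n)) \<le> \<eta> / 2 * real n"
      using \<eta> by (intro mult_left_mono) auto
    then have "g n \<le> \<eta> / 2 * real n"
      using elim(1) by simp
    then have "2 powr g n \<le> 2 powr (\<eta> / 2 * real n)"
      by simp
    then have "C * 2 powr g n \<le> 2 powr (\<eta> / 2 * real n) * 2 powr (\<eta> / 2 * real n)"
      using elim(2) by (intro mult_mono) auto
    also have "\<dots> = 2 powr (\<eta> * real n)"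
      by (simp flip: powr_add)
    finally show ?case
      using elim(3) by simp
  qed
qed

theorem theorem1p3:
  fixes g :: "nat \<Rightarrow> real" and t :: "nat \<Rightarrow> nat"
  assumes "g \<in> o[sequentially](\<lambda>n. real n / log 2 (real n))"
    and "\<And>n. t n > 0"
    and "(\<lambda>n. real (t n)) \<in> O[sequentially](\<lambda>n. 2 powr g n)"
  shows "(\<lambda>n. real (La n (t n))) \<sim>[sequentially] (\<lambda>n. real (n choose (n div 2)))"
proof (rule asymp_equivI', rule tendstoI)
  fix e :: real
  assume "0 < e"
  \<comment> \<open>The final error is 64z from the middle part plus z from the tail; e/66 keeps 65z
    below e. The cap 1/64 is what 1 / (1 - 32z) \<le> 1 + 64z requires.\<close>
  define z where "z = min (1 / 64) (e / 66)"
  have z: "0 < z" "z \<le> 1 / 64" "65 * z < e"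
    using \<open>0 < e\<close> by (auto simp: z_def min_def)
  have "\<forall>\<^sub>F n in sequentially. real (t n) \<le> 2 powr (z\<^sup>2 / 2 * real n)"
    using assms(1,3) z(1) by (intro eventually_subexponential) auto
  \<comment> \<open>The exponent equals -z^4 n / 2, and this exponential decay beats the factor n +
    1 lost in comparing 2^n with the central binomial coefficient.\<close>
  moreover have "\<forall>\<^sub>F n in sequentially. (real n + 1) * (2 * exp (- 2 * (z\<^sup>2 * real n / 2)\<^sup>2 / real n)) \<le> z"
    using z(1) by real_asymp
  ultimately show "\<forall>\<^sub>F n in sequentially. dist (real (La n (t n)) / real (n choose (n div 2))) 1 < e"
    using eventually_gt_at_top[of 0]
  proof eventually_elim
    case (elim n)
    let ?b = "real (n choose (n div 2))"
    let ?x = "2 * exp (- 2 * (z\<^sup>2 * real n / 2)\<^sup>2 / real n)"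
    have b: "0 < ?b"
      by (simp add: zero_less_binomial_iff)
    have "2 ^ n \<le> (real n + 1) * ?b"
      using two_power_le_central_binomial[of n, THEN of_nat_mono[where 'a = real]]
      by (simp add: algebra_simps)
    then have "2 ^ n * ?x \<le> ((real n + 1) * ?b) * ?x"
      by (rule mult_right_mono) simp
    also have "\<dots> = ((real n + 1) * ?x) * ?b"
      by (simp only: mult_ac)
    also have "\<dots> \<le> z * ?b"
      using elim(2) by (rule mult_right_mono) simp
    finally have tail: "2 ^ n * ?x \<le> z * ?b" .
    have "1 \<le> (1 + 64 * z) * (1 - 32 * z)"
      using mult_nonneg_nonneg[of z "1 - 64 * z"] z by (simp add: algebra_simps)
    then have "1 / (1 - 32 * z) \<le> 1 + 64 * z"
      using z by (simp add: pos_divide_le_eq)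
    then have "?b / (1 - 32 * z) \<le> (1 + 64 * z) * ?b"
      using mult_right_mono[of "1 / (1 - 32 * z)" "1 + 64 * z" ?b] by simp
    moreover have "real (La n (t n)) \<le> ?b / (1 - 32 * z) + 2 ^ n * ?x"
      using z elim by (intro La_le) auto
    ultimately have "real (La n (t n)) \<le> (1 + 65 * z) * ?b"
      using tail by (simp add: algebra_simps)
    then have "real (La n (t n)) / ?b \<le> 1 + 65 * z"
      using b by (simp add: pos_divide_le_eq)
    moreover have "1 \<le> real (La n (t n)) / ?b"
      using b central_binomial_le_La[OF assms(2), of n n] by (simp add: pos_le_divide_eq)
    ultimately show ?case
      using z(3) by (simp add: dist_real_def)
  qed
qed

end
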